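(* Let $p$ be an odd prime, let $n\ge 0$ and $k\ge 1$ be integers, let $\bar{\alpha}=(\alpha_0,\dots,\alpha_{n-1})$ be a tuple of elements of $\mathbb{C}_p$, let $\bar{r}=(r_0,\dots,r_{n-1})$ be a tuple of nonnegative integers, and put $|r|=r_0+r_1+\cdots+r_{n-1}$. Let $$\check{C}h_{n;\bar{\alpha},\bar{r}}^{(k)}=\int_{\mathbb{Z}_p}\cdots\int_{\mathbb{Z}_p}\prod_{i=0}^{n-1}(x_1x_2\cdots x_k-\alpha_i)^{r_i}\,d\mu_{-1}(x_1)\cdots d\mu_{-1}(x_k)$$ be the multiparameter Changhee numbers. Then $$\check{C}h_{n;\bar{\alpha},\bar{r}}^{(k)}=\sum_{m=0}^{|r|}s_{\bar{\alpha}}(n,m;\bar{r})\sum_{\ell_1=0}^{m}\cdots\sum_{\ell_k=0}^{m}\ \prod_{i=1}^{k}S(m,\ell_i)\,Ch_{\ell_i}.$$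
   Context: The fermionic $p$-adic integral of a continuous function $f$ on $\mathbb{Z}_p$ (here, a polynomial function with coefficients in $\mathbb{C}_p$) is $\int_{\mathbb{Z}_p}f(x)\,d\mu_{-1}(x)=\lim_{N\to\infty}\sum_{x=0}^{p^N-1}f(x)(-1)^x$, and multiple integrals are iterated integrals. The generalized Comtet numbers of the first kind $s_{\bar{\alpha}}(n,m;\bar{r})$ are defined by the polynomial identity $\prod_{i=0}^{n-1}(x-\alpha_i)^{r_i}=\sum_{m=0}^{|r|}s_{\bar{\alpha}}(n,m;\bar{r})\,x^m$. $S(m,\ell)$ are the usual Stirling numbers of the second kind, $x^m=\sum_{\ell=0}^m S(m,\ell)(x)_\ell$, with $(x)_\ell=x(x-1)\cdots(x-\ell+1)$ and $(x)_0=1$. The Changhee numbers $Ch_\ell\in\mathbb{Q}$ are defined by $\frac{2}{t+2}=\sum_{\ell=0}^\infty Ch_\ell\frac{t^\ell}{\ell!}$; equivalently $Ch_\ell=\int_{\mathbb{Z}_p}(x)_\ell\,d\mu_{-1}(x)$. *)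

theory Defs
  imports
    "HOL-Analysis.Analysis"
    "HOL-Computational_Algebra.Computational_Algebra"
    "HOL-Combinatorics.Stirling"
    "HOL-Library.FuncSet"
begin

definition padic_abs :: "nat \<Rightarrow> rat \<Rightarrow> real" where
  "padic_abs p q =
     (if q = 0 then 0
      else (case quotient_of q of (a, b) \<Rightarrow>
        real p powi (int (multiplicity (int p) b) - int (multiplicity (int p) a))))"

definition algebraic_elements_over :: "'a::field set \<Rightarrow> 'a set" where
  "algebraic_elements_over F =
     {x. \<exists>f. f \<noteq> 0 \<and> (\<forall>i. coeff f i \<in> F) \<and> poly f x = 0}"

definition algebraically_closed_on :: "'a::field set \<Rightarrow> bool" where
  "algebraically_closed_on F \<longleftrightarrow>
     (\<forall>f. degree f > 0 \<and> (\<forall>i. coeff f i \<in> F) \<longrightarrow> (\<exists>x\<in>F. poly f x = 0))"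

(* The type 'a, with absolute value nrm, is a model of C_p: it is the completion of an algebraic
   closure of Q_p, where Q_p is the completion of the rationals for the p-adic absolute value.
   Completeness of 'a (and hence of the closed subset Q_p) comes from the class complete_space;
   within 'a, a completion of a subfield is its closure.  These conditions determine
   C_p up to isometric isomorphism. *)
locale padic_complex_field =
  fixes p :: nat and nrm :: "'a::{field_char_0, complete_space} \<Rightarrow> real"
  assumes dist_eq_nrm: "dist x y = nrm (x - y)"
    and nrm_mult: "nrm (x * y) = nrm x * nrm y"
    and nrm_ultrametric: "nrm (x + y) \<le> max (nrm x) (nrm y)"
    and nrm_of_rat: "nrm (of_rat q) = padic_abs p q"
    and closed_Qp_closure:
      "algebraically_closed_on (algebraic_elements_over (closure (\<rat> :: 'a set)))"
    and dense_Qp_closure: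
      "closure (algebraic_elements_over (closure (\<rat> :: 'a set))) = UNIV"

(* A function on Z_p is represented by any extension of it to C_p: only its values at the
   nonnegative integers enter the limit. *)
definition fermionic_integral ::
    "nat \<Rightarrow> ('a::{field_char_0, complete_space} \<Rightarrow> 'a) \<Rightarrow> 'a" where
  "fermionic_integral p f = lim (\<lambda>N. \<Sum>x<p ^ N. f (of_nat x) * (-1) ^ x)"

(* The argument list of f is [x_1, ..., x_k]; x_1 is integrated first (innermost), x_k last. *)
primrec iterated_fermionic_integral ::
    "nat \<Rightarrow> nat \<Rightarrow> ('a::{field_char_0, complete_space} list \<Rightarrow> 'a) \<Rightarrow> 'a" where
  "iterated_fermionic_integral p 0 f = f []"
| "iterated_fermionic_integral p (Suc k) f =
     fermionic_integral p (\<lambda>y. iterated_fermionic_integral p k (\<lambda>xs. f (xs @ [y])))"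

definition multiparameter_Changhee ::
    "nat \<Rightarrow> nat \<Rightarrow> nat \<Rightarrow> (nat \<Rightarrow> 'a::{field_char_0, complete_space}) \<Rightarrow> (nat \<Rightarrow> nat) \<Rightarrow> 'a" where
  "multiparameter_Changhee p k n \<alpha> r =
     iterated_fermionic_integral p k (\<lambda>xs. \<Prod>i<n. (prod_list xs - \<alpha> i) ^ r i)"

definition Comtet1 :: "(nat \<Rightarrow> 'a::comm_ring_1) \<Rightarrow> nat \<Rightarrow> nat \<Rightarrow> (nat \<Rightarrow> nat) \<Rightarrow> 'a" where
  "Comtet1 \<alpha> n m r = coeff (\<Prod>i<n. [:- \<alpha> i, 1:] ^ r i) m"

(* Exponential generating function 2 / (t + 2). *)
definition Changhee :: "nat \<Rightarrow> rat" where
  "Changhee l = fact l * fps_nth (fps_const 2 / (fps_X + fps_const 2)) l"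

end

theory Submission
  imports Defs
begin

text \<open>
  The integrand is a polynomial \<open>\<Sum>m. s m * (x\<^sub>1 \<cdots> x\<^sub>k) ^ m\<close> in the product of the variables, so
  each of its terms is a product of powers of the single variables. As the fermionic integral is
  linear, integrating one variable after the other turns the term of degree \<open>m\<close> into \<open>s m * I m ^ k\<close>,
  where \<open>I m\<close> is the integral of \<open>x ^ m\<close> (\<open>iterated_fermionic_integral_poly\<close>). Expanding \<open>x ^ m\<close>
  into falling factorials gives \<open>I m = \<Sum>l\<le>m. S(m,l) Ch\<^sub>l\<close>, and the \<open>k\<close>-th power of this sum is the
  sum over all tuples \<open>(l\<^sub>1, \<dots>, l\<^sub>k)\<close>.

  The analytic content is that the falling factorial \<open>(x)\<^sub>l\<close> has integral \<open>Ch\<^sub>l\<close>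
  (\<open>alternating_sum_falling_fact_tendsto\<close>). Here the integral equation
  \<open>\<integral> f(x + 1) + \<integral> f(x) = 2 f(0)\<close> is used at finite level: for odd \<open>q\<close> the sum
  \<open>\<Sum>x<q. (f(x + 1) + f(x)) (-1) ^ x\<close> telescopes to \<open>f(0) + f(q)\<close>. For \<open>f(x) = (x)\<^sub>l\<close> with \<open>l > 0\<close>
  the boundary term \<open>(q)\<^sub>l\<close> is a multiple of \<open>q = p ^ N\<close>, so it tends to \<open>0\<close>, while
  \<open>(x + 1)\<^sub>l - (x)\<^sub>l = l (x)\<^sub>l\<^sub>-\<^sub>1\<close>. Hence the alternating sums satisfy, up to an error tending
  to \<open>0\<close>, the recurrence \<open>2 Ch\<^sub>l + l Ch\<^sub>l\<^sub>-\<^sub>1 = 0\<close> that the generating function \<open>2 / (t + 2)\<close>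
  imposes on the Changhee numbers.
\<close>

section \<open>Falling factorials, Stirling numbers and Changhee numbers\<close>

text \<open>On natural numbers, \<open>x (x - 1) \<cdots> (x - l + 1)\<close> equals this product also for \<open>x < l\<close>, where both
  vanish; in this form Pascal's rule is the difference equation below.\<close>

definition falling_fact :: "nat \<Rightarrow> nat \<Rightarrow> nat" where
  "falling_fact x l = fact l * (x choose l)"

lemma falling_fact_0_right [simp]: "falling_fact x 0 = 1"
  by (simp add: falling_fact_def)

lemma falling_fact_0_Suc [simp]: "falling_fact 0 (Suc l) = 0"
  by (simp add: falling_fact_def)

lemma falling_fact_Suc_Suc:
  "falling_fact (Suc x) (Suc l) = falling_fact x (Suc l) + Suc l * falling_fact x l"
  by (simp add: falling_fact_def algebra_simps)

lemma falling_fact_absorb: "falling_fact x (Suc l) = x * falling_fact (x - 1) l"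
proof -
  have "falling_fact x (Suc l) = fact l * (Suc l * (x choose Suc l))"
    by (simp only: falling_fact_def fact_Suc of_nat_id mult.assoc mult.left_commute)
  then show ?thesis
    by (simp only: binomial_absorption falling_fact_def mult.left_commute)
qed

lemma mult_falling_fact: "x * falling_fact x l = falling_fact x (Suc l) + l * falling_fact x l"
proof (cases x)
  case (Suc y)
  show ?thesis
  proof (cases l)
    case (Suc j)
    have "falling_fact x (Suc l) + l * falling_fact x l
        = x * (falling_fact y (Suc j) + Suc j * falling_fact y j)"
      using \<open>x = Suc y\<close> Suc by (simp add: falling_fact_absorb[of "Suc y"] algebra_simps)
    then show ?thesis
      using \<open>x = Suc y\<close> Suc by (simp only: falling_fact_Suc_Suc)
  qed (simp add: falling_fact_def)
qed (cases l; simp)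

lemma power_eq_sum_Stirling: "x ^ m = (\<Sum>l\<le>m. Stirling m l * falling_fact x l)"
proof (induction m)
  case (Suc m)
  let ?f = "falling_fact x"
  have "x ^ Suc m = (\<Sum>l\<le>m. Stirling m l * (x * ?f l))"
    using Suc by (simp add: sum_distrib_left mult_ac)
  also have "\<dots> = (\<Sum>l\<le>m. l * Stirling m l * ?f l) + (\<Sum>l\<le>m. Stirling m l * ?f (Suc l))"
    by (simp add: mult_falling_fact algebra_simps sum.distrib)
  \<comment> \<open>The first sum may be extended to \<open>l = m + 1\<close> and started at \<open>l = 1\<close>, since both end terms are \<open>0\<close>.\<close>
  also have "(\<Sum>l\<le>m. l * Stirling m l * ?f l) = (\<Sum>l\<le>Suc m. l * Stirling m l * ?f l)"
    by simp
  also have "\<dots> = (\<Sum>l\<le>m. Suc l * Stirling m (Suc l) * ?f (Suc l))"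
    by (subst sum.atMost_Suc_shift) simp
  also have "\<dots> + (\<Sum>l\<le>m. Stirling m l * ?f (Suc l))
      = (\<Sum>l\<le>m. Stirling (Suc m) (Suc l) * ?f (Suc l))"
    by (simp add: sum.distrib [symmetric] algebra_simps)
  also have "\<dots> = (\<Sum>l\<le>Suc m. Stirling (Suc m) l * ?f l)"
    by (subst sum.atMost_Suc_shift) simp
  finally show ?case .
qed simp

lemma Changhee_0: "Changhee 0 = 1"
  by (simp add: Changhee_def fps_divide_unit)

text \<open>Comparing coefficients of \<open>t ^ (l + 1)\<close> in \<open>(t + 2) * (2 / (t + 2)) = 2\<close>.\<close>

lemma Changhee_Suc: "2 * Changhee (Suc l) = - of_nat (Suc l) * Changhee l"
proof -
  define B :: "rat fps" where "B = fps_const 2 / (fps_X + fps_const 2)"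
  have "B * (fps_X + fps_const 2) = fps_const 2"
    by (simp add: B_def fps_divide_unit mult.assoc inverse_mult_eq_1)
  then have "fps_nth (fps_X * B + fps_const 2 * B) (Suc l) = fps_nth (fps_const 2) (Suc l)"
    by (simp add: algebra_simps)
  then have "2 * fps_nth B (Suc l) = - fps_nth B l"
    by simp
  moreover have "2 * Changhee (Suc l) = fact (Suc l) * (2 * fps_nth B (Suc l))"
    by (simp only: Changhee_def B_def mult.left_commute)
  ultimately show ?thesis
    by (simp add: Changhee_def algebra_simps flip: B_def)
qed

lemma of_rat_Changhee_Suc:
  "2 * of_rat (Changhee (Suc l)) = (- of_nat (Suc l) * of_rat (Changhee l) :: 'a::field_char_0)"
  using arg_cong[OF Changhee_Suc, of "of_rat :: rat \<Rightarrow> 'a" l]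
  by (simp only: of_rat_mult of_rat_minus of_rat_of_nat_eq of_rat_numeral_eq)

section \<open>Alternating sums\<close>

definition alternating_sum :: "nat \<Rightarrow> (nat \<Rightarrow> 'a::comm_ring_1) \<Rightarrow> 'a" where
  "alternating_sum q f = (\<Sum>x<q. f x * (- 1) ^ x)"

lemma alternating_sum_telescope:
  assumes "odd q"
  shows "alternating_sum q (\<lambda>x. f (Suc x) + f x) = f 0 + f q"
proof -
  have "alternating_sum n (\<lambda>x. f (Suc x) + f x) = f 0 - (- 1) ^ n * f n" for n
    by (induction n) (simp_all add: alternating_sum_def algebra_simps)
  then show ?thesis
    using assms by simp
qed

lemma alternating_sum_falling_fact_Suc:
  assumes "odd q"
  shows "2 * alternating_sum q (\<lambda>x. of_nat (falling_fact x (Suc l)))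
      = of_nat (falling_fact q (Suc l))
        - of_nat (Suc l) * (alternating_sum q (\<lambda>x. of_nat (falling_fact x l)) :: 'a::comm_ring_1)"
proof -
  have "alternating_sum q (\<lambda>x. of_nat (falling_fact (Suc x) (Suc l)) + of_nat (falling_fact x (Suc l)))
      = 2 * alternating_sum q (\<lambda>x. of_nat (falling_fact x (Suc l)))
        + of_nat (Suc l) * (alternating_sum q (\<lambda>x. of_nat (falling_fact x l)) :: 'a)"
    by (simp add: alternating_sum_def falling_fact_Suc_Suc sum.distrib sum_distrib_left algebra_simps)
  then show ?thesis
    using alternating_sum_telescope[OF assms, of "\<lambda>x. of_nat (falling_fact x (Suc l)) :: 'a"]
    by (simp add: eq_diff_eq)
qed

lemma alternating_sum_one:
  assumes "odd q"
  shows "2 * alternating_sum q (\<lambda>x. 1) = (2 :: 'a::comm_ring_1)"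
  using alternating_sum_telescope[OF assms, of "\<lambda>x. 1 :: 'a"]
  by (simp add: alternating_sum_def flip: sum_distrib_left)

section \<open>Limits in the \<open>p\<close>-adic metric\<close>

text \<open>The metric is not tied to the ring structure by a type class, so continuity of the ring
  operations has to be derived from the absolute value.\<close>

context padic_complex_field
begin

lemma nrm_nonneg [simp]: "0 \<le> nrm x"
  using dist_eq_nrm[of x 0] zero_le_dist[of x 0] by simp

lemma nrm_0 [simp]: "nrm 0 = 0"
  using dist_eq_nrm[of 0 0] by simp

lemma nrm_1: "nrm 1 = 1"
  using nrm_of_rat[of 1] by (simp add: padic_abs_def)

lemma nrm_of_nat_le_1: "nrm (of_nat n) \<le> 1"
proof (induction n)
  case (Suc n)
  then show ?case
    using nrm_ultrametric[of 1 "of_nat n"] by (simp add: nrm_1)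
qed simp

lemma nrm_prime_less_1:
  assumes "prime p"
  shows "nrm (of_nat p) < 1"
proof -
  have "prime (int p)" and "p > 1"
    using assms prime_gt_1_nat by auto
  then have "nrm (of_rat (of_nat p)) < 1"
    unfolding nrm_of_rat
    by (simp add: padic_abs_def power_int_minus inverse_less_1_iff)
  then show ?thesis
    by simp
qed

lemma nrm_power: "nrm (x ^ n) = nrm x ^ n"
  by (induction n) (simp_all add: nrm_1 nrm_mult)

lemma tendsto_iff_nrm:
  fixes X :: "nat \<Rightarrow> 'a"
  shows "(X \<longlonglongrightarrow> L) \<longleftrightarrow> (\<lambda>N. nrm (X N - L)) \<longlonglongrightarrow> 0"
  by (simp add: tendsto_dist_iff[of X] dist_eq_nrm)

lemma nrm_tendsto_add:
  fixes X Y :: "nat \<Rightarrow> 'a"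
  assumes "X \<longlonglongrightarrow> L" and "Y \<longlonglongrightarrow> M"
  shows "(\<lambda>N. X N + Y N) \<longlonglongrightarrow> L + M"
  unfolding tendsto_iff_nrm
proof (rule tendsto_sandwich[OF _ _ tendsto_const])
  show "(\<lambda>N. max (nrm (X N - L)) (nrm (Y N - M))) \<longlonglongrightarrow> 0"
    using tendsto_max[of _ 0 sequentially _ 0] assms by (simp add: tendsto_iff_nrm)
  show "\<forall>\<^sub>F N in sequentially. nrm (X N + Y N - (L + M)) \<le> max (nrm (X N - L)) (nrm (Y N - M))"
    using nrm_ultrametric[of "X N - L" "Y N - M" for N] by (simp add: add_diff_add)
qed simp

lemma nrm_tendsto_mult_left:
  fixes X :: "nat \<Rightarrow> 'a"
  assumes "X \<longlonglongrightarrow> L"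
  shows "(\<lambda>N. c * X N) \<longlonglongrightarrow> c * L"
  using assms tendsto_mult_right_zero[of "\<lambda>N. nrm (X N - L)" sequentially "nrm c"]
  by (simp add: tendsto_iff_nrm nrm_mult flip: right_diff_distrib)

lemma nrm_tendsto_sum:
  fixes X :: "'i \<Rightarrow> nat \<Rightarrow> 'a"
  assumes "\<And>i. i \<in> A \<Longrightarrow> X i \<longlonglongrightarrow> L i"
  shows "(\<lambda>N. \<Sum>i\<in>A. X i N) \<longlonglongrightarrow> (\<Sum>i\<in>A. L i)"
  using assms by (induction A rule: infinite_finite_induct) (auto intro: nrm_tendsto_add)

lemma falling_fact_prime_power_tendsto_0:
  assumes "prime p"
  shows "(\<lambda>N. of_nat (falling_fact (p ^ N) (Suc l)) :: 'a) \<longlonglongrightarrow> 0"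
  unfolding tendsto_iff_nrm
proof (rule tendsto_sandwich[OF _ _ tendsto_const])
  show "(\<lambda>N. nrm (of_nat p) ^ N) \<longlonglongrightarrow> 0"
    using nrm_prime_less_1[OF assms] by (intro LIMSEQ_power_zero) simp
  have "nrm (of_nat (falling_fact (p ^ N) (Suc l))) \<le> nrm (of_nat p) ^ N" for N
    using nrm_of_nat_le_1[of "falling_fact (p ^ N - 1) l"]
    by (simp add: falling_fact_absorb nrm_mult nrm_power mult_left_le)
  then show "\<forall>\<^sub>F N in sequentially. nrm (of_nat (falling_fact (p ^ N) (Suc l)) - 0) \<le> nrm (of_nat p) ^ N"
    by simp
qed simp

section \<open>Fermionic integrals of polynomials\<close>

definition has_fermionic_integral :: "('a \<Rightarrow> 'a) \<Rightarrow> 'a \<Rightarrow> bool" where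
  "has_fermionic_integral f I \<longleftrightarrow> (\<lambda>N. alternating_sum (p ^ N) (\<lambda>x. f (of_nat x))) \<longlonglongrightarrow> I"

lemma fermionic_integral_eqI: "has_fermionic_integral f I \<Longrightarrow> fermionic_integral p f = I"
  unfolding has_fermionic_integral_def fermionic_integral_def alternating_sum_def by (rule limI)

lemma has_fermionic_integral_sum:
  assumes "\<And>i. i \<in> A \<Longrightarrow> has_fermionic_integral (f i) (I i)"
  shows "has_fermionic_integral (\<lambda>x. \<Sum>i\<in>A. c i * f i x) (\<Sum>i\<in>A. c i * I i)"
proof -
  have "alternating_sum q (\<lambda>x. \<Sum>i\<in>A. c i * f i (of_nat x))
      = (\<Sum>i\<in>A. c i * alternating_sum q (\<lambda>x. f i (of_nat x)))" for q
    unfolding alternating_sum_def sum_distrib_right sum_distrib_left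
    by (subst sum.swap) (simp add: mult.assoc)
  then show ?thesis
    using assms unfolding has_fermionic_integral_def
    by (auto intro!: nrm_tendsto_sum nrm_tendsto_mult_left)
qed

text \<open>The recurrences for the alternating sums and for the Changhee numbers have the same
  coefficients, so by induction on \<open>l\<close> the former converge to the latter; the inhomogeneous term
  is the falling factorial of \<open>p ^ N\<close>, which tends to \<open>0\<close>.\<close>

lemma alternating_sum_falling_fact_tendsto:
  assumes "prime p" and "odd p"
  shows "(\<lambda>N. alternating_sum (p ^ N) (\<lambda>x. of_nat (falling_fact x l)) :: 'a)
    \<longlonglongrightarrow> of_rat (Changhee l)"
proof (induction l)
  case 0
  have "alternating_sum (p ^ N) (\<lambda>x. 1) = (1 :: 'a)" for N
    using alternating_sum_one[of "p ^ N", where 'a = 'a] assms(2) by simp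
  then show ?case
    by (simp add: Changhee_0)
next
  case (Suc l)
  let ?A = "\<lambda>l N. alternating_sum (p ^ N) (\<lambda>x. of_nat (falling_fact x l)) :: 'a"
  have "?A (Suc l) N
      = 1 / 2 * (of_nat (falling_fact (p ^ N) (Suc l)) + - of_nat (Suc l) * ?A l N)" for N
    using alternating_sum_falling_fact_Suc[of "p ^ N" l, where 'a = 'a] assms(2)
    by (simp add: field_simps del: of_nat_Suc)
  moreover have "of_rat (Changhee (Suc l))
      = 1 / 2 * (0 + - of_nat (Suc l) * of_rat (Changhee l) :: 'a)"
    using of_rat_Changhee_Suc[of l, where 'a = 'a] by (simp add: field_simps del: of_nat_Suc)
  ultimately show ?case
    using assms(1)
    by (simp only:) (intro nrm_tendsto_mult_left nrm_tendsto_add Suc.IH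
        falling_fact_prime_power_tendsto_0)
qed

lemma has_fermionic_integral_power:
  assumes "prime p" and "odd p"
  shows "has_fermionic_integral (\<lambda>x. x ^ m)
    (\<Sum>l\<le>m. of_nat (Stirling m l) * of_rat (Changhee l))"
proof -
  have "alternating_sum q (\<lambda>x. of_nat x ^ m)
      = (\<Sum>l\<le>m. of_nat (Stirling m l) * (alternating_sum q (\<lambda>x. of_nat (falling_fact x l)) :: 'a))" for q
  proof -
    have "of_nat x ^ m = (\<Sum>l\<le>m. of_nat (Stirling m l) * of_nat (falling_fact x l) :: 'a)" for x
      using arg_cong[OF power_eq_sum_Stirling, of "of_nat :: nat \<Rightarrow> 'a" x m] by simp
    then show ?thesis
      unfolding alternating_sum_def sum_distrib_left
      by (simp only: sum_distrib_right) (subst sum.swap, simp add: mult.assoc)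
  qed
  then show ?thesis
    unfolding has_fermionic_integral_def
    using assms by (auto intro!: nrm_tendsto_sum nrm_tendsto_mult_left
        alternating_sum_falling_fact_tendsto)
qed

text \<open>Fixing the last variable as \<open>y\<close> multiplies the coefficient of degree \<open>m\<close> by \<open>y ^ m\<close>; hence the
  induction on \<open>k\<close> is over all coefficient families \<open>c\<close>.\<close>

lemma iterated_fermionic_integral_poly:
  assumes "\<And>m. has_fermionic_integral (\<lambda>x. x ^ m) (I m)"
  shows "iterated_fermionic_integral p k (\<lambda>xs. \<Sum>m\<in>A. c m * prod_list xs ^ m)
    = (\<Sum>m\<in>A. c m * I m ^ k)"
proof (induction k arbitrary: c)
  case (Suc k)
  have inner: "iterated_fermionic_integral p k (\<lambda>xs. \<Sum>m\<in>A. c m * prod_list (xs @ [y]) ^ m)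
      = (\<Sum>m\<in>A. c m * I m ^ k * y ^ m)" for y
    using Suc.IH[of "\<lambda>m. c m * y ^ m"] by (simp add: power_mult_distrib mult_ac)
  have "has_fermionic_integral (\<lambda>y. \<Sum>m\<in>A. c m * I m ^ k * y ^ m) (\<Sum>m\<in>A. c m * I m ^ k * I m)"
    by (intro has_fermionic_integral_sum assms)
  then have "fermionic_integral p (\<lambda>y. \<Sum>m\<in>A. c m * I m ^ k * y ^ m)
      = (\<Sum>m\<in>A. c m * I m ^ k * I m)"
    by (rule fermionic_integral_eqI)
  then show ?case
    unfolding iterated_fermionic_integral.simps inner by (simp add: mult_ac)
qed simp

end

section \<open>Multiparameter Changhee numbers\<close>

lemma prod_power_eq_sum_Comtet1:
  fixes \<alpha> :: "nat \<Rightarrow> 'a::idom"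
  shows "(\<Prod>i<n. (x - \<alpha> i) ^ r i) = (\<Sum>m = 0..(\<Sum>i<n. r i). Comtet1 \<alpha> n m r * x ^ m)"
proof -
  let ?P = "\<Prod>i<n. [:- \<alpha> i, 1:] ^ r i"
  have "degree ?P = (\<Sum>i<n. r i)"
    by (subst degree_prod_sum_eq) (simp_all add: degree_power_eq)
  moreover have "poly ?P x = (\<Prod>i<n. (x - \<alpha> i) ^ r i)"
    by (simp add: poly_prod)
  ultimately show ?thesis
    using poly_altdef[of ?P x] by (simp add: Comtet1_def atMost_atLeast0)
qed

theorem theorem2p1:
  fixes p n k :: nat
    and nrm :: "'a::{field_char_0, complete_space} \<Rightarrow> real"
    and \<alpha> :: "nat \<Rightarrow> 'a"
    and r :: "nat \<Rightarrow> nat"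
  assumes "prime p" and "odd p"
    and "padic_complex_field p nrm"
    and "k \<ge> 1"
  shows "multiparameter_Changhee p k n \<alpha> r =
    (\<Sum>m = 0..(\<Sum>i<n. r i). Comtet1 \<alpha> n m r *
      (\<Sum>l \<in> {1..k} \<rightarrow>\<^sub>E {0..m}.
        \<Prod>i = 1..k. of_nat (Stirling m (l i)) * of_rat (Changhee (l i))))"
proof -
  interpret padic_complex_field p nrm
    by (rule assms(3))
  let ?g = "\<lambda>m l. of_nat (Stirling m l) * of_rat (Changhee l) :: 'a"
  have "multiparameter_Changhee p k n \<alpha> r
      = (\<Sum>m = 0..(\<Sum>i<n. r i). Comtet1 \<alpha> n m r * (\<Sum>l\<le>m. ?g m l) ^ k)"
    unfolding multiparameter_Changhee_def prod_power_eq_sum_Comtet1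
    by (rule iterated_fermionic_integral_poly) (rule has_fermionic_integral_power[OF assms(1,2)])
  moreover have "(\<Sum>l\<le>m. ?g m l) ^ k = (\<Sum>l \<in> {1..k} \<rightarrow>\<^sub>E {0..m}. \<Prod>i = 1..k. ?g m (l i))" for m
    by (subst prod_sum_PiE [symmetric]) (simp_all add: atMost_atLeast0)
  ultimately show ?thesis
    by simp
qed

end
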